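(* Let $X=\{1,2,3\}$ with the discrete topology, so $C(X,[0,1])=[0,1]^3$, and let $\cdot$ be the usual multiplication on $[0,1]$. There exists a functional $\mu:C(X,[0,1])\to[0,1]$ that is monotone, $\vee$-homogeneous and $\cdot$-homogeneous, but does not preserve $\vee$ for comonotone functions; that is, there are comonotone $\varphi,\psi\in C(X,[0,1])$ with $\mu(\varphi\vee\psi)\ne\mu(\varphi)\vee\mu(\psi)$.
   Context: $C(X,[0,1])$ is the set of (continuous) functions $X\to[0,1]$; $\vee$ denotes (pointwise) maximum and $\cdot$ (pointwise) multiplication. For $c\in[0,1]$, $c_X$ is the constant function on $X$ with value $c$. A functional $\mu:C(X,[0,1])\to[0,1]$ (an arbitrary map) is monotone if $\varphi\le\psi$ (pointwise) implies $\mu(\varphi)\le\mu(\psi)$; $\vee$-homogeneous if $\mu(c_X\vee\varphi)=c\vee\mu(\varphi)$ for all $c\in[0,1]$ and $\varphi\in C(X,[0,1])$; $\cdot$-homogeneous if $\mu(c_X\cdot\varphi)=c\cdot\mu(\varphi)$ for all $c\in[0,1]$ and $\varphi\in C(X,[0,1])$. Two functions $\varphi,\psi$ are comonotone if $(\varphi(x_1)-\varphi(x_2))\cdot(\psi(x_1)-\psi(x_2))\ge0$ for all $x_1,x_2\in X$. *)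

theory Defs
  imports "HOL-Analysis.Analysis"
begin

text \<open>
  A space is a value \<open>X :: 'a topology\<close>. A function on \<open>X\<close> is represented by an extensional
  function (equal to \<open>undefined\<close> outside \<open>topspace X\<close>), so that equality of functions on \<open>X\<close> is HOL
  equality and a functional on them cannot see values outside \<open>X\<close>.
\<close>

definition unit_functions :: "'a topology \<Rightarrow> ('a \<Rightarrow> real) set" where
  "unit_functions X =
     {\<phi> \<in> extensional (topspace X). continuous_map X (top_of_set {0..1}) \<phi>}"

definition const_fun :: "'a topology \<Rightarrow> real \<Rightarrow> 'a \<Rightarrow> real" where
  "const_fun X c = (\<lambda>x\<in>topspace X. c)"

definition max_fun :: "'a topology \<Rightarrow> ('a \<Rightarrow> real) \<Rightarrow> ('a \<Rightarrow> real) \<Rightarrow> 'a \<Rightarrow> real" where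
  "max_fun X \<phi> \<psi> = (\<lambda>x\<in>topspace X. max (\<phi> x) (\<psi> x))"

definition mult_fun :: "'a topology \<Rightarrow> ('a \<Rightarrow> real) \<Rightarrow> ('a \<Rightarrow> real) \<Rightarrow> 'a \<Rightarrow> real" where
  "mult_fun X \<phi> \<psi> = (\<lambda>x\<in>topspace X. \<phi> x * \<psi> x)"

definition monotone_functional :: "'a topology \<Rightarrow> (('a \<Rightarrow> real) \<Rightarrow> real) \<Rightarrow> bool" where
  "monotone_functional X \<mu> \<longleftrightarrow>
     (\<forall>\<phi>\<in>unit_functions X. \<forall>\<psi>\<in>unit_functions X.
        (\<forall>x\<in>topspace X. \<phi> x \<le> \<psi> x) \<longrightarrow> \<mu> \<phi> \<le> \<mu> \<psi>)"

definition max_homogeneous :: "'a topology \<Rightarrow> (('a \<Rightarrow> real) \<Rightarrow> real) \<Rightarrow> bool" where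
  "max_homogeneous X \<mu> \<longleftrightarrow>
     (\<forall>c\<in>{0..1}. \<forall>\<phi>\<in>unit_functions X. \<mu> (max_fun X (const_fun X c) \<phi>) = max c (\<mu> \<phi>))"

definition mult_homogeneous :: "'a topology \<Rightarrow> (('a \<Rightarrow> real) \<Rightarrow> real) \<Rightarrow> bool" where
  "mult_homogeneous X \<mu> \<longleftrightarrow>
     (\<forall>c\<in>{0..1}. \<forall>\<phi>\<in>unit_functions X. \<mu> (mult_fun X (const_fun X c) \<phi>) = c * \<mu> \<phi>)"

definition comonotone :: "'a topology \<Rightarrow> ('a \<Rightarrow> real) \<Rightarrow> ('a \<Rightarrow> real) \<Rightarrow> bool" where
  "comonotone X \<phi> \<psi> \<longleftrightarrow>
     (\<forall>x1\<in>topspace X. \<forall>x2\<in>topspace X. (\<phi> x1 - \<phi> x2) * (\<psi> x1 - \<psi> x2) \<ge> 0)"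

lemma unit_functions_discrete: "unit_functions (discrete_topology S) = S \<rightarrow>\<^sub>E {0..1}"
  by (auto simp: unit_functions_def PiE_def)

end

theory Submission
  imports Defs
begin

text \<open>
  The functional \<open>\<mu> \<phi> = max (\<phi> 3) (min (\<phi> 2) (\<phi> 1 / 2))\<close> works. Halving does not commute with
  \<open>max c\<close>, but \<open>max c x / 2 \<le> max c (x / 2)\<close>, and the term \<open>\<phi> 3\<close> hides the difference because
  it becomes at least \<open>c\<close>; so \<open>\<mu>\<close> is \<open>max\<close>-homogeneous. On the comonotone functions
  \<open>(1, 0, 0)\<close> and \<open>(1/2, 1/2, 0)\<close> it takes the values \<open>0\<close> and \<open>1/4\<close>, but \<open>1/2\<close> on their
  maximum \<open>(1, 1/2, 0)\<close>.
\<close>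

theorem mainTheorem3:
  fixes X :: "nat topology"
  assumes "X = discrete_topology {1, 2, 3}"
  shows "\<exists>\<mu> \<in> unit_functions X \<rightarrow> {0..1}.
           monotone_functional X \<mu> \<and> max_homogeneous X \<mu> \<and> mult_homogeneous X \<mu> \<and>
           (\<exists>\<phi>\<in>unit_functions X. \<exists>\<psi>\<in>unit_functions X.
              comonotone X \<phi> \<psi> \<and> \<mu> (max_fun X \<phi> \<psi>) \<noteq> max (\<mu> \<phi>) (\<mu> \<psi>))"
proof -
  define \<mu> :: "(nat \<Rightarrow> real) \<Rightarrow> real" where "\<mu> \<phi> = max (\<phi> 3) (min (\<phi> 2) (\<phi> 1 / 2))" for \<phi>
  have space: "topspace X = {1, 2, 3}"
    using assms by simp
  have unit: "unit_functions X = {1, 2, 3} \<rightarrow>\<^sub>E {0..1}"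
    using assms by (simp add: unit_functions_discrete)
  have bounds: "0 \<le> \<phi> i" "\<phi> i \<le> 1" if "\<phi> \<in> unit_functions X" "i \<in> {1, 2, 3}" for \<phi> i
    using PiE_mem[OF that[unfolded unit]] by auto
  have "\<mu> \<in> unit_functions X \<rightarrow> {0..1}"
  proof
    fix \<phi> assume "\<phi> \<in> unit_functions X"
    from bounds[OF this, of 1] bounds[OF this, of 2] bounds[OF this, of 3]
    show "\<mu> \<phi> \<in> {0..1}"
      by (auto simp: \<mu>_def)
  qed
  moreover have "monotone_functional X \<mu>"
    by (auto simp: monotone_functional_def space \<mu>_def max_def min_def)
  \<comment> \<open>Expanding every \<open>max\<close> and \<open>min\<close> leaves linear
    inequalities; nonnegativity of \<open>c\<close> enters as c / 2 \<le> c.\<close>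
  moreover have "max_homogeneous X \<mu>"
    by (auto simp: max_homogeneous_def max_fun_def const_fun_def space \<mu>_def max_def min_def)
  \<comment> \<open>Multiplication by \<open>c\<close> \<ge> 0 preserves order, so it distributes
    over \<open>max\<close> and \<open>min\<close>, and it commutes with halving.\<close>
  moreover have "mult_homogeneous X \<mu>"
    by (auto simp: mult_homogeneous_def mult_fun_def const_fun_def space \<mu>_def
        max_mult_distrib_left min_mult_distrib_left)
  moreover have "\<exists>\<phi>\<in>unit_functions X. \<exists>\<psi>\<in>unit_functions X.
    comonotone X \<phi> \<psi> \<and> \<mu> (max_fun X \<phi> \<psi>) \<noteq> max (\<mu> \<phi>) (\<mu> \<psi>)"
  proof -
    let ?\<phi> = "\<lambda>x\<in>{1, 2, 3::nat}. if x = 1 then 1 else 0 :: real"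
    let ?\<psi> = "\<lambda>x\<in>{1, 2, 3::nat}. if x = 3 then 0 else 1 / 2 :: real"
    have "?\<phi> \<in> unit_functions X" "?\<psi> \<in> unit_functions X"
      by (auto simp: unit)
    \<comment> \<open>Both functions are nonincreasing along 1, 2, 3, so their differences never
      have opposite signs.\<close>
    moreover have "comonotone X ?\<phi> ?\<psi>"
      by (simp add: comonotone_def space)
    moreover have "\<mu> (max_fun X ?\<phi> ?\<psi>) \<noteq> max (\<mu> ?\<phi>) (\<mu> ?\<psi>)"
      by (simp add: \<mu>_def max_fun_def space)
    ultimately show ?thesis
      by blast
  qed
  ultimately show ?thesis
    by blast
qed

end
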